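(* Let $E\ge1$, let $M,\Delta>0$, $\mathbf{g},\boldsymbol{\ell}_0,\mathbf{r}_0\in\mathbb{R}^3$, and for each $e=1,\dots,E$ let $0\le\sigma_e<\varepsilon_e$ be integers, with $\alpha_{e,t}=1$ if $\sigma_e\le t<\varepsilon_e$ and $\alpha_{e,t}=0$ otherwise. For each $e$ let $(\boldsymbol{\varphi}_{e,t})_{t\ge-2}$ be vectors in $\mathbb{R}^3$ with $\boldsymbol{\varphi}_{e,t}=\mathbf{0}$ for all $t<\sigma_e$, and set $\mathbf{f}_{e,t}=\boldsymbol{\varphi}_{e,t}-2\boldsymbol{\varphi}_{e,t-1}+\boldsymbol{\varphi}_{e,t-2}$ for $t\ge0$. Define the linear momentum and center of mass by $$\dot{\boldsymbol{\ell}}_t=M\mathbf{g}+\sum_{e}\alpha_{e,t}\mathbf{f}_{e,t},\qquad \boldsymbol{\ell}_t=\boldsymbol{\ell}_0+\Delta\sum_{i=0}^{t-1}\dot{\boldsymbol{\ell}}_i,\qquad M\mathbf{r}_t=M\mathbf{r}_0+\Delta\sum_{i=0}^{t-1}\boldsymbol{\ell}_i .$$ Then for every integer $t\ge0$, $$\dot{\boldsymbol{\ell}}_t=M\mathbf{g}+\sum_e\dot{\boldsymbol{\ell}}_{e,t},\qquad \boldsymbol{\ell}_t=\boldsymbol{\ell}_0+\Delta tM\mathbf{g}+\Delta\sum_e\boldsymbol{\ell}_{e,t},$$ $$M\mathbf{r}_t=M\mathbf{r}_0+\Delta t\,\boldsymbol{\ell}_0+\Delta^2\frac{t(t-1)}{2}M\mathbf{g}+\Delta^2\sum_eM\mathbf{r}_{e,t},$$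 where $$\dot{\boldsymbol{\ell}}_{e,t}=\begin{cases}\boldsymbol{\varphi}_{e,t}-2\boldsymbol{\varphi}_{e,t-1}+\boldsymbol{\varphi}_{e,t-2},&t<\varepsilon_e\\ \mathbf{0},&t\ge\varepsilon_e,\end{cases}\qquad \boldsymbol{\ell}_{e,t}=\begin{cases}\boldsymbol{\varphi}_{e,t-1}-\boldsymbol{\varphi}_{e,t-2},&t<\varepsilon_e\\ \boldsymbol{\varphi}_{e,\varepsilon_e-1}-\boldsymbol{\varphi}_{e,\varepsilon_e-2},&t\ge\varepsilon_e,\end{cases}$$ $$M\mathbf{r}_{e,t}=\begin{cases}\boldsymbol{\varphi}_{e,t-2},&t<\varepsilon_e\\ \boldsymbol{\varphi}_{e,\varepsilon_e-2}+(t-\varepsilon_e)(\boldsymbol{\varphi}_{e,\varepsilon_e-1}-\boldsymbol{\varphi}_{e,\varepsilon_e-2}),&t\ge\varepsilon_e.\end{cases}$$ In particular, apart from the constants $M,\Delta,\mathbf{g},\boldsymbol{\ell}_0,\mathbf{r}_0$, the states $\boldsymbol{\ell}_t$ and $\mathbf{r}_t$ depend only on the variables $\boldsymbol{\varphi}_{e,t'}$ with $t'\in\{t-2,t-1,\varepsilon_e-1,\varepsilon_e-2\}$, $e=1,\dots,E$.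
   Context: Interpretation: $e$ indexes contact phases, phase $e$ being active for integer times $t\in[\sigma_e,\varepsilon_e)$; $\mathbf{f}_{e,t}$ is the contact force, $M$ the mass, $\mathbf{g}$ gravity, $\Delta$ the time step, and $\boldsymbol{\varphi}_{e,t}$ are the twice-integrated contact forces used as decision variables. The quantities $\dot{\boldsymbol\ell}_t$, $\dot{\boldsymbol\ell}_{e,t}$, $M\mathbf r_{e,t}$ are just symbols (no continuous differentiation is involved). *)

theory Defs
  imports "HOL-Analysis.Analysis"
begin

text \<open>
  Contact phases are indexed by \<open>e \<in> {1..E}\<close>, times are integers. The decision variables
  \<open>\<phi> e t\<close> are meaningful for \<open>t \<ge> -2\<close> only; as total functions on \<open>int\<close> they have arbitrary
  values below \<open>-2\<close>, which are never read at a time \<open>t \<ge> 0\<close>.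
\<close>

definition active :: "(nat \<Rightarrow> int) \<Rightarrow> (nat \<Rightarrow> int) \<Rightarrow> nat \<Rightarrow> int \<Rightarrow> real" where
  "active \<sigma> \<epsilon> e t = (if \<sigma> e \<le> t \<and> t < \<epsilon> e then 1 else 0)"

definition contact_force :: "(nat \<Rightarrow> int \<Rightarrow> real^3) \<Rightarrow> nat \<Rightarrow> int \<Rightarrow> real^3" where
  "contact_force \<phi> e t = \<phi> e t - 2 *\<^sub>R \<phi> e (t - 1) + \<phi> e (t - 2)"

definition momentum_rate ::
  "nat \<Rightarrow> real \<Rightarrow> real^3 \<Rightarrow> (nat \<Rightarrow> int) \<Rightarrow> (nat \<Rightarrow> int) \<Rightarrow> (nat \<Rightarrow> int \<Rightarrow> real^3) \<Rightarrow> int \<Rightarrow> real^3" where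
  "momentum_rate E M g \<sigma> \<epsilon> \<phi> t =
     M *\<^sub>R g + (\<Sum>e\<in>{1..E}. active \<sigma> \<epsilon> e t *\<^sub>R contact_force \<phi> e t)"

definition momentum ::
  "nat \<Rightarrow> real \<Rightarrow> real \<Rightarrow> real^3 \<Rightarrow> real^3 \<Rightarrow> (nat \<Rightarrow> int) \<Rightarrow> (nat \<Rightarrow> int)
     \<Rightarrow> (nat \<Rightarrow> int \<Rightarrow> real^3) \<Rightarrow> int \<Rightarrow> real^3" where
  "momentum E M \<Delta> g l0 \<sigma> \<epsilon> \<phi> t =
     l0 + \<Delta> *\<^sub>R (\<Sum>i\<in>{0..t - 1}. momentum_rate E M g \<sigma> \<epsilon> \<phi> i)"

definition center_of_mass ::
  "nat \<Rightarrow> real \<Rightarrow> real \<Rightarrow> real^3 \<Rightarrow> real^3 \<Rightarrow> real^3 \<Rightarrow> (nat \<Rightarrow> int) \<Rightarrow> (nat \<Rightarrow> int)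
     \<Rightarrow> (nat \<Rightarrow> int \<Rightarrow> real^3) \<Rightarrow> int \<Rightarrow> real^3" where
  "center_of_mass E M \<Delta> g l0 r0 \<sigma> \<epsilon> \<phi> t =
     (1 / M) *\<^sub>R (M *\<^sub>R r0 + \<Delta> *\<^sub>R (\<Sum>i\<in>{0..t - 1}. momentum E M \<Delta> g l0 \<sigma> \<epsilon> \<phi> i))"

lemma scaled_center_of_mass:
  assumes "M \<noteq> 0"
  shows "M *\<^sub>R center_of_mass E M \<Delta> g l0 r0 \<sigma> \<epsilon> \<phi> t =
     M *\<^sub>R r0 + \<Delta> *\<^sub>R (\<Sum>i\<in>{0..t - 1}. momentum E M \<Delta> g l0 \<sigma> \<epsilon> \<phi> i)"
  using assms by (simp add: center_of_mass_def)

text \<open>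
  Per-phase contributions. \<open>phase_scaled_com\<close> is the single symbol usually written as mass times
  per-phase position; there is no separate factor \<open>M\<close> in it.
\<close>

definition phase_momentum_rate ::
  "(nat \<Rightarrow> int) \<Rightarrow> (nat \<Rightarrow> int \<Rightarrow> real^3) \<Rightarrow> nat \<Rightarrow> int \<Rightarrow> real^3" where
  "phase_momentum_rate \<epsilon> \<phi> e t =
     (if t < \<epsilon> e then \<phi> e t - 2 *\<^sub>R \<phi> e (t - 1) + \<phi> e (t - 2) else 0)"

definition phase_momentum ::
  "(nat \<Rightarrow> int) \<Rightarrow> (nat \<Rightarrow> int \<Rightarrow> real^3) \<Rightarrow> nat \<Rightarrow> int \<Rightarrow> real^3" where
  "phase_momentum \<epsilon> \<phi> e t =
     (if t < \<epsilon> e then \<phi> e (t - 1) - \<phi> e (t - 2)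
      else \<phi> e (\<epsilon> e - 1) - \<phi> e (\<epsilon> e - 2))"

definition phase_scaled_com ::
  "(nat \<Rightarrow> int) \<Rightarrow> (nat \<Rightarrow> int \<Rightarrow> real^3) \<Rightarrow> nat \<Rightarrow> int \<Rightarrow> real^3" where
  "phase_scaled_com \<epsilon> \<phi> e t =
     (if t < \<epsilon> e then \<phi> e (t - 2)
      else \<phi> e (\<epsilon> e - 2) + real_of_int (t - \<epsilon> e) *\<^sub>R (\<phi> e (\<epsilon> e - 1) - \<phi> e (\<epsilon> e - 2)))"

end

(*
  Both sides of each identity satisfy the same first-order recurrence in t. The force is the second
  difference of phi, so the per-phase rate is the forward difference of the per-phase momentum,
  which is the forward difference of the per-phase position, also across t = epsilon; the values
  at t = 0 vanish because phi does before sigma.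
*)
theory Submission
  imports Defs
begin

text \<open>Peels the last term off a sum over integer times, which turns the defining sums into
  recurrences in \<open>t\<close>. At \<open>t = 0\<close> the remaining range
  \<open>{0..t - 1}\<close> is empty.\<close>

lemma sum_int_atLeast0_add1:
  fixes f :: "int \<Rightarrow> 'a::comm_monoid_add"
  assumes "t \<ge> 0"
  shows "(\<Sum>i\<in>{0..t}. f i) = (\<Sum>i\<in>{0..t - 1}. f i) + f t"
proof -
  have "{0..t} = insert t {0..t - 1}"
    using assms by auto
  then show ?thesis
    by (simp add: add.commute)
qed

lemma momentum_add1:
  assumes "t \<ge> 0"
  shows "momentum E M \<Delta> g l0 \<sigma> \<epsilon> \<phi> (t + 1) =
    momentum E M \<Delta> g l0 \<sigma> \<epsilon> \<phi> t + \<Delta> *\<^sub>R momentum_rate E M g \<sigma> \<epsilon> \<phi> t"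
  using assms by (simp add: momentum_def sum_int_atLeast0_add1 scaleR_right_distrib)

lemma scaled_center_of_mass_add1:
  assumes "t \<ge> 0" and "M \<noteq> 0"
  shows "M *\<^sub>R center_of_mass E M \<Delta> g l0 r0 \<sigma> \<epsilon> \<phi> (t + 1) =
    M *\<^sub>R center_of_mass E M \<Delta> g l0 r0 \<sigma> \<epsilon> \<phi> t + \<Delta> *\<^sub>R momentum E M \<Delta> g l0 \<sigma> \<epsilon> \<phi> t"
  using assms
  by (simp add: scaled_center_of_mass sum_int_atLeast0_add1 scaleR_right_distrib del: scaleR_cancel_left)

lemma phase_momentum_add1:
  "phase_momentum \<epsilon> \<phi> e (t + 1) = phase_momentum \<epsilon> \<phi> e t + phase_momentum_rate \<epsilon> \<phi> e t"
proof -
  consider "t + 1 < \<epsilon> e" | "\<epsilon> e = t + 1" | "t \<ge> \<epsilon> e"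
    by linarith
  then show ?thesis
    by cases (simp_all add: phase_momentum_def phase_momentum_rate_def scaleR_2)
qed

lemma phase_scaled_com_add1:
  "phase_scaled_com \<epsilon> \<phi> e (t + 1) = phase_scaled_com \<epsilon> \<phi> e t + phase_momentum \<epsilon> \<phi> e t"
proof -
  consider "t + 1 < \<epsilon> e" | "\<epsilon> e = t + 1" | "t \<ge> \<epsilon> e"
    by linarith
  then show ?thesis
    by cases (simp_all add: phase_scaled_com_def phase_momentum_def algebra_simps)
qed

context
  fixes E :: nat and \<sigma> \<epsilon> :: "nat \<Rightarrow> int" and \<phi> :: "nat \<Rightarrow> int \<Rightarrow> real^3"
  assumes phases: "\<forall>e\<in>{1..E}. 0 \<le> \<sigma> e \<and> \<sigma> e < \<epsilon> e"
    and vanish: "\<forall>e\<in>{1..E}. \<forall>s. -2 \<le> s \<and> s < \<sigma> e \<longrightarrow> \<phi> e s = 0"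
begin

text \<open>The lower cutoff of \<open>active\<close> is absorbed by \<open>\<phi>\<close>: for
  \<open>0 \<le> t < \<sigma> e\<close> the second difference reads only times from
  \<open>-2\<close> up to \<open>t\<close>, where \<open>\<phi> e\<close> vanishes. During the phase
  both sides agree by definition, afterwards both are zero.\<close>

lemma momentum_rate_eq:
  assumes "t \<ge> 0"
  shows "momentum_rate E M g \<sigma> \<epsilon> \<phi> t = M *\<^sub>R g + (\<Sum>e\<in>{1..E}. phase_momentum_rate \<epsilon> \<phi> e t)"
proof -
  have "active \<sigma> \<epsilon> e t *\<^sub>R contact_force \<phi> e t = phase_momentum_rate \<epsilon> \<phi> e t"
    if "e \<in> {1..E}" for e
    using that phases vanish assms
    by (auto simp: active_def contact_force_def phase_momentum_rate_def)
  then show ?thesis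
    by (simp add: momentum_rate_def)
qed

lemma momentum_eq:
  assumes "t \<ge> 0"
  shows "momentum E M \<Delta> g l0 \<sigma> \<epsilon> \<phi> t =
    l0 + (\<Delta> * real_of_int t * M) *\<^sub>R g + \<Delta> *\<^sub>R (\<Sum>e\<in>{1..E}. phase_momentum \<epsilon> \<phi> e t)"
  using assms
proof (induction t rule: int_ge_induct)
  case base
  \<comment> \<open>Since \<open>0 < \<epsilon> e\<close>, the first branch applies and reads times
    \<open>-1\<close> and \<open>-2\<close>, both before \<open>\<sigma> e\<close>.\<close>
  have "phase_momentum \<epsilon> \<phi> e 0 = 0" if "e \<in> {1..E}" for e
    using bspec[OF phases that] bspec[OF vanish that] by (simp add: phase_momentum_def)
  then show ?case
    by (simp add: momentum_def)
next
  case (step t)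
  then show ?case
    by (simp add: momentum_add1 momentum_rate_eq phase_momentum_add1 sum.distrib scaleR_right_distrib
        scaleR_left_distrib distrib_left distrib_right)
qed

text \<open>Summing the closed form of the momentum once more: the constant \<open>l0\<close>
  contributes \<open>t\<close> copies, the linear gravity term a triangular number.\<close>

lemma scaled_center_of_mass_eq:
  assumes "t \<ge> 0" and "M \<noteq> 0"
  shows "M *\<^sub>R center_of_mass E M \<Delta> g l0 r0 \<sigma> \<epsilon> \<phi> t =
    M *\<^sub>R r0 + (\<Delta> * real_of_int t) *\<^sub>R l0
    + (\<Delta>^2 * (real_of_int t * (real_of_int t - 1) / 2) * M) *\<^sub>R g
    + \<Delta>^2 *\<^sub>R (\<Sum>e\<in>{1..E}. phase_scaled_com \<epsilon> \<phi> e t)"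
  using assms(1)
proof (induction t rule: int_ge_induct)
  case base
  have "phase_scaled_com \<epsilon> \<phi> e 0 = 0" if "e \<in> {1..E}" for e
    using bspec[OF phases that] bspec[OF vanish that] by (simp add: phase_scaled_com_def)
  then show ?case
    using \<open>M \<noteq> 0\<close> by (simp add: center_of_mass_def)
next
  case (step t)
  \<comment> \<open>The triangular number for \<open>t + 1\<close> exceeds that for \<open>t\<close>
    by \<open>t\<close>; the last summand is \<open>\<Delta>\<close> times the gravity coefficient
    in \<open>momentum_eq\<close>.\<close>
  have "\<Delta>^2 * (real_of_int (t + 1) * (real_of_int (t + 1) - 1) / 2) * M =
      \<Delta>^2 * (real_of_int t * (real_of_int t - 1) / 2) * M + \<Delta> * (\<Delta> * real_of_int t * M)"
    by (simp add: field_simps power2_eq_square)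
  note gravity = arg_cong[OF this, where f = "\<lambda>c. c *\<^sub>R g", unfolded scaleR_left_distrib]
  show ?case
    unfolding scaled_center_of_mass_add1[OF \<open>0 \<le> t\<close> \<open>M \<noteq> 0\<close>] step.IH gravity
    using \<open>0 \<le> t\<close>
    by (simp add: momentum_eq phase_scaled_com_add1 sum.distrib scaleR_right_distrib
        scaleR_left_distrib distrib_left power2_eq_square)
qed

end

theorem mainTheorem4:
  fixes E :: nat
    and M \<Delta> :: real
    and g l0 r0 :: "real^3"
    and \<sigma> \<epsilon> :: "nat \<Rightarrow> int"
    and \<phi> :: "nat \<Rightarrow> int \<Rightarrow> real^3"
  assumes "E \<ge> 1" and "M > 0" and "\<Delta> > 0"
    and "\<forall>e\<in>{1..E}. 0 \<le> \<sigma> e \<and> \<sigma> e < \<epsilon> e"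
    and "\<forall>e\<in>{1..E}. \<forall>s. -2 \<le> s \<and> s < \<sigma> e \<longrightarrow> \<phi> e s = 0"
  shows "\<forall>t\<ge>0.
      momentum_rate E M g \<sigma> \<epsilon> \<phi> t = M *\<^sub>R g + (\<Sum>e\<in>{1..E}. phase_momentum_rate \<epsilon> \<phi> e t) \<and>
      momentum E M \<Delta> g l0 \<sigma> \<epsilon> \<phi> t =
        l0 + (\<Delta> * real_of_int t * M) *\<^sub>R g + \<Delta> *\<^sub>R (\<Sum>e\<in>{1..E}. phase_momentum \<epsilon> \<phi> e t) \<and>
      M *\<^sub>R center_of_mass E M \<Delta> g l0 r0 \<sigma> \<epsilon> \<phi> t =
        M *\<^sub>R r0 + (\<Delta> * real_of_int t) *\<^sub>R l0
        + (\<Delta>^2 * (real_of_int t * (real_of_int t - 1) / 2) * M) *\<^sub>R g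
        + \<Delta>^2 *\<^sub>R (\<Sum>e\<in>{1..E}. phase_scaled_com \<epsilon> \<phi> e t) \<and>
      (\<forall>\<phi>'. (\<forall>e\<in>{1..E}. \<forall>s. -2 \<le> s \<and> s < \<sigma> e \<longrightarrow> \<phi>' e s = 0) \<longrightarrow>
         (\<forall>e\<in>{1..E}. \<forall>s\<in>{t - 2, t - 1, \<epsilon> e - 1, \<epsilon> e - 2}. \<phi>' e s = \<phi> e s) \<longrightarrow>
         momentum E M \<Delta> g l0 \<sigma> \<epsilon> \<phi>' t = momentum E M \<Delta> g l0 \<sigma> \<epsilon> \<phi> t \<and>
         center_of_mass E M \<Delta> g l0 r0 \<sigma> \<epsilon> \<phi>' t = center_of_mass E M \<Delta> g l0 r0 \<sigma> \<epsilon> \<phi> t)"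
proof (intro allI impI conjI)
  fix t :: int
  assume "0 \<le> t"
  note phase = assms(4,5) \<open>0 \<le> t\<close>
  have "M \<noteq> 0"
    using \<open>M > 0\<close> by simp
  show "momentum_rate E M g \<sigma> \<epsilon> \<phi> t = M *\<^sub>R g + (\<Sum>e\<in>{1..E}. phase_momentum_rate \<epsilon> \<phi> e t)"
    by (rule momentum_rate_eq[OF phase])
  show "momentum E M \<Delta> g l0 \<sigma> \<epsilon> \<phi> t =
      l0 + (\<Delta> * real_of_int t * M) *\<^sub>R g + \<Delta> *\<^sub>R (\<Sum>e\<in>{1..E}. phase_momentum \<epsilon> \<phi> e t)"
    by (rule momentum_eq[OF phase])
  show "M *\<^sub>R center_of_mass E M \<Delta> g l0 r0 \<sigma> \<epsilon> \<phi> t =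
      M *\<^sub>R r0 + (\<Delta> * real_of_int t) *\<^sub>R l0
      + (\<Delta>^2 * (real_of_int t * (real_of_int t - 1) / 2) * M) *\<^sub>R g
      + \<Delta>^2 *\<^sub>R (\<Sum>e\<in>{1..E}. phase_scaled_com \<epsilon> \<phi> e t)"
    by (rule scaled_center_of_mass_eq[OF phase \<open>M \<noteq> 0\<close>])
  \<comment> \<open>Dependence on few variables is read off the closed forms, which hold for
    \<open>\<phi>'\<close> as well because it also vanishes before each
    \<open>\<sigma> e\<close>.\<close>
  fix \<phi>' :: "nat \<Rightarrow> int \<Rightarrow> real^3"
  assume "\<forall>e\<in>{1..E}. \<forall>s. -2 \<le> s \<and> s < \<sigma> e \<longrightarrow> \<phi>' e s = 0"
  note phase' = assms(4) this \<open>0 \<le> t\<close>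
  assume agree: "\<forall>e\<in>{1..E}. \<forall>s\<in>{t - 2, t - 1, \<epsilon> e - 1, \<epsilon> e - 2}. \<phi>' e s = \<phi> e s"
  \<comment> \<open>Whichever branch applies, only the four times in \<open>agree\<close> are
    read.\<close>
  have "(\<Sum>e\<in>{1..E}. phase_momentum \<epsilon> \<phi>' e t) = (\<Sum>e\<in>{1..E}. phase_momentum \<epsilon> \<phi> e t)"
    using agree by (intro sum.cong) (simp_all add: phase_momentum_def)
  then show "momentum E M \<Delta> g l0 \<sigma> \<epsilon> \<phi>' t = momentum E M \<Delta> g l0 \<sigma> \<epsilon> \<phi> t"
    by (simp only: momentum_eq[OF phase] momentum_eq[OF phase'])
  have "(\<Sum>e\<in>{1..E}. phase_scaled_com \<epsilon> \<phi>' e t) = (\<Sum>e\<in>{1..E}. phase_scaled_com \<epsilon> \<phi> e t)"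
    using agree by (intro sum.cong) (simp_all add: phase_scaled_com_def)
  then have "M *\<^sub>R center_of_mass E M \<Delta> g l0 r0 \<sigma> \<epsilon> \<phi>' t =
      M *\<^sub>R center_of_mass E M \<Delta> g l0 r0 \<sigma> \<epsilon> \<phi> t"
    by (simp only: scaled_center_of_mass_eq[OF phase \<open>M \<noteq> 0\<close>]
        scaled_center_of_mass_eq[OF phase' \<open>M \<noteq> 0\<close>])
  then show "center_of_mass E M \<Delta> g l0 r0 \<sigma> \<epsilon> \<phi>' t = center_of_mass E M \<Delta> g l0 r0 \<sigma> \<epsilon> \<phi> t"
    using \<open>M \<noteq> 0\<close> by simp
qed

end
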